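(* Let $\xi$ be an $\mathrm{ab}3$ position. Then $\xi+\overline{\xi}\equiv 0\pmod{\mathrm{cl}(\xi,\overline{\xi})}$.
   Context: A position $\xi=\{\xi^L \mid \xi^R\}$ is given recursively by finite sets of Left and Right options; $0=\{\cdot\mid\cdot\}$. The conjugate is $\overline{\xi}=\{\overline{\xi^R}\mid\overline{\xi^L}\}$. A position is all-small if Left can move in it iff Right can, and every option is all-small. A position is $\mathrm{ab}n$ if it is all-small, binary (from every position in its game tree each player has at most one option), and every alternating path in its game tree (a sequence of moves from the root alternating between Left and Right moves) has length at most $n$. Disjunctive sum: $\alpha+\beta=\{\alpha^L+\beta,\alpha+\beta^L \mid \alpha^R+\beta,\alpha+\beta^R\}$. Under misère play a player unable to move on their turn wins; $o^-$ denotes misère outcome ($\mathcal{L}$, $\mathcal{R}$, $\mathcal{N}$ next player wins, $\mathcal{P}$ next player loses). $\mathrm{cl}(\alpha,\beta)$ is the smallest set containing $\alpha,\beta$ closed under disjunctive sum and taking options. For a closed set $\Gamma$, $\alpha\equiv\beta\pmod\Gamma$ means $o^-(\alpha+\gamma)=o^-(\beta+\gamma)$ for all $\gamma\in\Gamma$.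
   Formalization: The bound 3 is required of alternating paths starting at any position of the game tree, not only at the root; with root-only paths the claim fails, e.g. for ξ={{V|0}|0}, V={{0|{{*|0}|0}}|{{0|{0|*}}|0}}, where ξ+ξ̄+* is N but * is P. *)

theory Defs
  imports Main "HOL-Library.FSet"
begin

section \<open>Positions\<close>

datatype player = PLeft | PRight

fun opponent :: "player \<Rightarrow> player" where
  "opponent PLeft = PRight"
| "opponent PRight = PLeft"

datatype game = Game (left_opts: "game fset") (right_opts: "game fset")

fun opts_of :: "player \<Rightarrow> game \<Rightarrow> game fset" where
  "opts_of PLeft G = left_opts G"
| "opts_of PRight G = right_opts G"

lemma size_fset_member: "x |\<in>| A \<Longrightarrow> f x < size_fset f A"
proof -
  assume "x |\<in>| A"
  then have "(Suc \<circ> f) x \<le> (\<Sum>y\<in>fset A. (Suc \<circ> f) y)"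
    by (intro member_le_sum) auto
  then show ?thesis by (simp add: size_fset.rep_eq)
qed

lemma size_left_option [termination_simp]: "H |\<in>| left_opts G \<Longrightarrow> size H < size G"
  by (cases G) (auto dest!: size_fset_member[where f = size])

lemma size_right_option [termination_simp]: "H |\<in>| right_opts G \<Longrightarrow> size H < size G"
  by (cases G) (auto dest!: size_fset_member[where f = size])

lemma size_option [termination_simp]: "H |\<in>| opts_of p G \<Longrightarrow> size H < size G"
  by (cases p) (auto intro: size_left_option size_right_option)

declare fimage_cong [fundef_cong]

instantiation game :: zero
begin
definition zero_game :: game where "0 = Game {||} {||}"
instance ..
end

fun conjugate :: "game \<Rightarrow> game" where
  "conjugate G = Game (conjugate |`| right_opts G) (conjugate |`| left_opts G)"

declare conjugate.simps [simp del]

fun game_sum :: "game \<Rightarrow> game \<Rightarrow> game" where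
  "game_sum G H = Game
     (((\<lambda>G'. game_sum G' H) |`| left_opts G) |\<union>| ((\<lambda>H'. game_sum G H') |`| left_opts H))
     (((\<lambda>G'. game_sum G' H) |`| right_opts G) |\<union>| ((\<lambda>H'. game_sum G H') |`| right_opts H))"

declare game_sum.simps [simp del]

instantiation game :: plus
begin
definition plus_game :: "game \<Rightarrow> game \<Rightarrow> game" where "G + H = game_sum G H"
instance ..
end

lemma plus_game_unfold:
  fixes G H :: game
  shows "G + H = Game
     (((\<lambda>G'. G' + H) |`| left_opts G) |\<union>| ((\<lambda>H'. G + H') |`| left_opts H))
     (((\<lambda>G'. G' + H) |`| right_opts G) |\<union>| ((\<lambda>H'. G + H') |`| right_opts H))"
  unfolding plus_game_def by (rule game_sum.simps)

section \<open>All-small binary positions\<close>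

inductive_set game_tree :: "game \<Rightarrow> game set" for G :: game where
  root: "G \<in> game_tree G"
| move: "H \<in> game_tree G \<Longrightarrow> K |\<in>| opts_of p H \<Longrightarrow> K \<in> game_tree G"

fun all_small :: "game \<Rightarrow> bool" where
  "all_small G \<longleftrightarrow>
     (left_opts G \<noteq> {||} \<longleftrightarrow> right_opts G \<noteq> {||}) \<and>
     (\<forall>H |\<in>| left_opts G. all_small H) \<and>
     (\<forall>H |\<in>| right_opts G. all_small H)"

declare all_small.simps [simp del]

definition binary :: "game \<Rightarrow> bool" where
  "binary G \<longleftrightarrow> (\<forall>H \<in> game_tree G. \<forall>p. fcard (opts_of p H) \<le> 1)"

text \<open>
  \<open>alternating_path p G Hs\<close>: starting at \<open>G\<close> with \<open>p\<close> to move, the players can move alternately,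
  \<open>Hs\<close> being the positions reached; the length of the path is the number of moves.
\<close>

fun alternating_path :: "player \<Rightarrow> game \<Rightarrow> game list \<Rightarrow> bool" where
  "alternating_path p G [] \<longleftrightarrow> True"
| "alternating_path p G (H # Hs) \<longleftrightarrow> H |\<in>| opts_of p G \<and> alternating_path (opponent p) H Hs"

text \<open>
  The alternating paths in the game tree of \<open>G\<close> may start at any position of the tree, so options
  of an \<open>abn n\<close> position are \<open>abn n\<close>. Bounding only the paths that start at \<open>G\<close> itself would leave
  positions reached by consecutive moves of one player unrestricted, and even a bound of 2 on those
  paths does not make \<open>G + conjugate G\<close> equivalent to 0: with \<open>* = {0|0}\<close> take \<open>G = {{V|0}|0}\<close> where
  \<open>V = {{0|{{*|0}|0}}|{{0|{0|*}}|0}}\<close>. Then \<open>*\<close> has outcome P but \<open>G + conjugate G + *\<close> has outcome N.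
\<close>

definition abn :: "nat \<Rightarrow> game \<Rightarrow> bool" where
  "abn n G \<longleftrightarrow> all_small G \<and> binary G \<and>
     (\<forall>H \<in> game_tree G. \<forall>p Hs. alternating_path p H Hs \<longrightarrow> length Hs \<le> n)"

section \<open>Misere play\<close>

fun wins_moving_first :: "player \<Rightarrow> game \<Rightarrow> bool" where
  "wins_moving_first p G \<longleftrightarrow>
     opts_of p G = {||} \<or> (\<exists>H |\<in>| opts_of p G. \<not> wins_moving_first (opponent p) H)"

declare wins_moving_first.simps [simp del]

datatype outcome = Outcome_L | Outcome_R | Outcome_N | Outcome_P

definition misere_outcome :: "game \<Rightarrow> outcome" where
  "misere_outcome G =
     (if wins_moving_first PLeft G
      then (if wins_moving_first PRight G then Outcome_N else Outcome_L)
      else (if wins_moving_first PRight G then Outcome_R else Outcome_P))"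

inductive_set cl :: "game \<Rightarrow> game \<Rightarrow> game set" for A B :: game where
  left_generator: "A \<in> cl A B"
| right_generator: "B \<in> cl A B"
| sum: "G \<in> cl A B \<Longrightarrow> H \<in> cl A B \<Longrightarrow> G + H \<in> cl A B"
| option: "G \<in> cl A B \<Longrightarrow> H |\<in>| opts_of p G \<Longrightarrow> H \<in> cl A B"

definition equiv_mod :: "game \<Rightarrow> game \<Rightarrow> game set \<Rightarrow> bool" where
  "equiv_mod G H \<Gamma> \<longleftrightarrow> (\<forall>K \<in> \<Gamma>. misere_outcome (G + K) = misere_outcome (H + K))"

end

theory Submission
  imports Defs
begin

text \<open>
  Since everything is all-small, a player who wins \<open>K\<close> also wins \<open>G + conjugate G + K\<close>: follow the
  winning strategy in \<open>K\<close> and answer every move in \<open>G + conjugate G\<close> by its mirror image. This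
  breaks down only when \<open>K\<close> has been played out with the player to move, so it suffices that
  the player to move wins \<open>H + conjugate H\<close> for every \<open>H\<close> in the game tree.

  Say the player to move has an alternating run of length \<open>l\<close> in \<open>H\<close> and the opponent one of
  length \<open>r\<close>; in \<open>conjugate H\<close> the lengths are interchanged, and a single binary component is
  won by the player to move iff the corresponding length is even. If the opponent mirrors the
  first move, induction applies. Otherwise the bound 3 lets the player reach
  a single component: if \<open>l\<close> is odd, exhaust \<open>H\<close>, leaving the opponent to move in \<open>conjugate H\<close>
  with odd length \<open>l\<close>; symmetrically if \<open>r\<close> is odd. If \<open>l = r = 2\<close>, a non-mirroring
  reply exhausts \<open>H\<close> and leaves the player to move in \<open>conjugate H\<close> with even length \<open>r\<close>.
\<close>

section \<open>Options and winning moves in sums and conjugates\<close>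

lemma opponent_opponent [simp]: "opponent (opponent p) = p"
  by (cases p) auto

lemma opts_of_zero [simp]: "opts_of p 0 = {||}"
  by (cases p) (auto simp: zero_game_def)

lemma opts_of_plus:
  "opts_of p (G + H) = (\<lambda>G'. G' + H) |`| opts_of p G |\<union>| (\<lambda>H'. G + H') |`| opts_of p H"
  by (subst plus_game_unfold, cases p) simp_all

lemma opts_of_conjugate: "opts_of p (conjugate G) = conjugate |`| opts_of (opponent p) G"
  by (subst conjugate.simps, cases p) simp_all

lemma game_eqI: "(\<And>p. opts_of p G = opts_of p H) \<Longrightarrow> G = H"
  by (metis game.expand opts_of.simps)

lemma plus_zero_right [simp]: "(G :: game) + 0 = G"
proof (induction G rule: measure_induct_rule[of size])
  case (less G)
  have "(\<lambda>G'. G' + 0) |`| opts_of p G = id |`| opts_of p G" for p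
    by (rule fimage_cong) (auto simp: less size_option)
  then show ?case by (intro game_eqI) (simp add: opts_of_plus)
qed

lemma plus_zero_left [simp]: "0 + (G :: game) = G"
proof (induction G rule: measure_induct_rule[of size])
  case (less G)
  have "(\<lambda>G'. 0 + G') |`| opts_of p G = id |`| opts_of p G" for p
    by (rule fimage_cong) (auto simp: less size_option)
  then show ?case by (intro game_eqI) (simp add: opts_of_plus)
qed

lemma conjugate_zero [simp]: "conjugate 0 = 0"
  by (intro game_eqI) (simp add: opts_of_conjugate)

lemma wins_moving_firstI:
  "H |\<in>| opts_of p G \<Longrightarrow> \<not> wins_moving_first (opponent p) H \<Longrightarrow> wins_moving_first p G"
  by (subst wins_moving_first.simps) blast

lemma wins_moving_first_zero [simp]: "wins_moving_first p 0"
  by (subst wins_moving_first.simps) simp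

text \<open>The first premise is the misere clause: a player who cannot move has already
  won.\<close>

lemma not_wins_moving_firstI:
  assumes "opts_of p G \<noteq> {||}"
    and "\<And>H. H |\<in>| opts_of p G \<Longrightarrow> wins_moving_first (opponent p) H"
  shows "\<not> wins_moving_first p G"
  using assms by (subst wins_moving_first.simps) blast

section \<open>All-small positions\<close>

lemma all_small_option: "all_small G \<Longrightarrow> H |\<in>| opts_of p G \<Longrightarrow> all_small H"
  by (cases p) (auto simp: all_small.simps[of G])

text \<open>If one player is stuck, so is the other, and \<open>0\<close> is the only position
  without any options.\<close>

lemma all_small_opts_empty_iff: "all_small G \<Longrightarrow> opts_of p G = {||} \<longleftrightarrow> G = 0"
  using all_small.simps[of G] by (cases p; cases G) (auto simp: zero_game_def)

lemma all_smallI: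
  assumes "opts_of PLeft G = {||} \<longleftrightarrow> opts_of PRight G = {||}"
    and "\<And>p H. H |\<in>| opts_of p G \<Longrightarrow> all_small H"
  shows "all_small G"
  using assms(1) assms(2)[of _ PLeft] assms(2)[of _ PRight] by (subst all_small.simps) auto

lemma all_small_conjugate: "all_small G \<Longrightarrow> all_small (conjugate G)"
proof (induction G rule: measure_induct_rule[of size])
  case (less G)
  show ?case
  proof (rule all_smallI)
    show "opts_of PLeft (conjugate G) = {||} \<longleftrightarrow> opts_of PRight (conjugate G) = {||}"
      using all_small_opts_empty_iff[OF less.prems] by (simp add: opts_of_conjugate del: opts_of.simps)
  qed (auto simp: opts_of_conjugate intro: less size_option all_small_option)
qed

text \<open>A player is stuck in the sum iff stuck in both summands; for all-small summands this
  means that both are \<open>0\<close>, whoever the player is.\<close>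

lemma all_small_plus: "all_small G \<Longrightarrow> all_small H \<Longrightarrow> all_small (G + H)"
proof (induction "size G + size H" arbitrary: G H rule: less_induct)
  case less
  show ?case
  proof (rule all_smallI)
    show "opts_of PLeft (G + H) = {||} \<longleftrightarrow> opts_of PRight (G + H) = {||}"
      using all_small_opts_empty_iff[OF less.prems(1)] all_small_opts_empty_iff[OF less.prems(2)]
      by (simp add: opts_of_plus del: opts_of.simps)
  next
    fix p K assume "K |\<in>| opts_of p (G + H)"
    then show "all_small K"
      using less.prems
      by (auto simp: opts_of_plus intro!: less.hyps dest: size_option intro: all_small_option)
  qed
qed

lemma all_small_cl:
  assumes "all_small A" "all_small B" "G \<in> cl A B"
  shows "all_small G"
  using assms(3)
  by induction (auto intro: assms(1,2) all_small_plus all_small_option)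

section \<open>Binary all-small positions with bounded alternation\<close>

text \<open>The inductive definition extends a path at its far end; inductions that descend to an
  option need to extend it at the root.\<close>

lemma game_tree_option: "K |\<in>| opts_of p G \<Longrightarrow> H \<in> game_tree K \<Longrightarrow> H \<in> game_tree G"
  by (erule game_tree.induct) (auto intro: game_tree.intros)

lemma abn_option: "abn n G \<Longrightarrow> H |\<in>| opts_of p G \<Longrightarrow> abn n H"
  unfolding abn_def binary_def by (blast intro: game_tree_option all_small_option)

text \<open>Being binary gives at most one option, and being all-small and nonzero gives at least
  one.\<close>

lemma abn_opts_of:
  assumes "abn n G" "G \<noteq> 0"
  obtains A where "opts_of p G = {|A|}"
proof -
  have "opts_of p G \<noteq> {||}"
    using assms all_small_opts_empty_iff by (auto simp: abn_def)
  moreover have "fcard (opts_of p G) \<le> 1"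
    using assms(1) game_tree.root by (auto simp: abn_def binary_def)
  ultimately have "card (fset (opts_of p G)) = 1"
    by (auto simp: fcard.rep_eq le_Suc_eq)
  then obtain A where "opts_of p G = {|A|}"
    by (metis bot_fset.rep_eq card_1_singletonE finsert.rep_eq fset_inject)
  then show thesis by (rule that)
qed

text \<open>Length of a longest alternating run started by \<open>p\<close>. Taking
  \<open>fMax\<close> covers arbitrary positions; in a binary one the run is forced.\<close>

fun alt_length :: "player \<Rightarrow> game \<Rightarrow> nat" where
  "alt_length p G = (if opts_of p G = {||} then 0
     else Suc (fMax ((\<lambda>H. alt_length (opponent p) H) |`| opts_of p G)))"

declare alt_length.simps [simp del]

lemma alt_length_zero [simp]: "alt_length p 0 = 0"
  by (subst alt_length.simps) simp

lemma alt_length_singleton: "opts_of p G = {|A|} \<Longrightarrow> alt_length p G = Suc (alt_length (opponent p) A)"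
  by (subst alt_length.simps) simp

lemma alt_length_eq_0_iff: "all_small G \<Longrightarrow> alt_length p G = 0 \<longleftrightarrow> G = 0"
  by (subst alt_length.simps) (simp add: all_small_opts_empty_iff)

lemma alternating_path_alt_length: "\<exists>Hs. alternating_path p G Hs \<and> length Hs = alt_length p G"
proof (induction G arbitrary: p rule: measure_induct_rule[of size])
  case (less G)
  show ?case
  proof (cases "opts_of p G = {||}")
    case True
    then show ?thesis by (intro exI[of _ "[]"]) (simp add: alt_length.simps[of p G])
  next
    case False
    then have "fMax (alt_length (opponent p) |`| opts_of p G) |\<in>| alt_length (opponent p) |`| opts_of p G"
      by (intro fMax_in) simp
    then obtain H where H: "H |\<in>| opts_of p G" "alt_length p G = Suc (alt_length (opponent p) H)"
      using False by (auto simp: alt_length.simps[of p G])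
    then obtain Hs where "alternating_path (opponent p) H Hs" "length Hs = alt_length (opponent p) H"
      using less size_option by blast
    with H show ?thesis by (intro exI[of _ "H # Hs"]) simp
  qed
qed

lemma abn_alt_length_le: "abn n G \<Longrightarrow> alt_length p G \<le> n"
  using alternating_path_alt_length[of p G] game_tree.root unfolding abn_def by fastforce

text \<open>Play in a single binary component is forced, and whoever is to move at its end wins;
  each move flips both the parity and the winner.\<close>

lemma wins_moving_first_iff_even_alt_length:
  "abn n G \<Longrightarrow> wins_moving_first p G \<longleftrightarrow> even (alt_length p G)"
proof (induction G arbitrary: p rule: measure_induct_rule[of size])
  case (less G)
  show ?case
  proof (cases "G = 0")
    case True
    then show ?thesis by simp
  next
    case False
    with less.prems obtain A where A: "opts_of p G = {|A|}" by (rule abn_opts_of)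
    then have opt: "A |\<in>| opts_of p G" by simp
    have "wins_moving_first (opponent p) A \<longleftrightarrow> even (alt_length (opponent p) A)"
      using less.IH[OF size_option[OF opt] abn_option[OF less.prems opt]] .
    with A show ?thesis
      by (subst wins_moving_first.simps) (simp add: alt_length_singleton)
  qed
qed

text \<open>In \<open>conjugate G\<close> player \<open>p\<close> starts the mirror image of the run
  that the opponent starts in \<open>G\<close>. A direct induction keeps \<open>abn\<close> as a
  hypothesis on \<open>G\<close> itself.\<close>

lemma wins_moving_first_conjugate_iff:
  "abn n G \<Longrightarrow> wins_moving_first p (conjugate G) \<longleftrightarrow> even (alt_length (opponent p) G)"
proof (induction G arbitrary: p rule: measure_induct_rule[of size])
  case (less G)
  show ?case
  proof (cases "G = 0")
    case True
    then show ?thesis by simp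
  next
    case False
    with less.prems obtain A where A: "opts_of (opponent p) G = {|A|}" by (rule abn_opts_of)
    then have opt: "A |\<in>| opts_of (opponent p) G" by simp
    have "wins_moving_first (opponent p) (conjugate A) \<longleftrightarrow> even (alt_length p A)"
      using less.IH[OF size_option[OF opt] abn_option[OF less.prems opt], of "opponent p"] by simp
    with A show ?thesis
      by (subst wins_moving_first.simps) (simp add: alt_length_singleton opts_of_conjugate)
  qed
qed

lemma abn_3_wins_plus_conjugate: "abn 3 G \<Longrightarrow> wins_moving_first p (G + conjugate G)"
proof (induction G rule: measure_induct_rule[of size])
  case (less G)
  let ?q = "opponent p" and ?C = "conjugate G"
  let ?l = "alt_length p G" and ?r = "alt_length (opponent p) G"
  show ?case
  proof (cases "G = 0")
    case True
    then show ?thesis by simp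
  next
    case False
    obtain A where A: "opts_of p G = {|A|}" using abn_opts_of[OF less.prems False] .
    obtain B where B: "opts_of ?q G = {|B|}" using abn_opts_of[OF less.prems False] .
    have abnA: "abn 3 A" and abnB: "abn 3 B"
      using less.prems A B by (auto intro: abn_option[of 3 G])
    \<comment> \<open>\<open>IH_A\<close> and \<open>IH_B\<close> are the positions after a mirrored
      first exchange, with \<open>p\<close> to move again.\<close>
    have IH_A: "wins_moving_first p (A + conjugate A)"
      using less.IH[OF size_option[of A p G] abnA] A by simp
    have IH_B: "wins_moving_first p (B + conjugate B)"
      using less.IH[OF size_option[of B ?q G] abnB] B by simp
    have lA: "?l = Suc (alt_length ?q A)" using A by (rule alt_length_singleton)
    have rB: "?r = Suc (alt_length p B)" using alt_length_singleton[OF B] by simp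
    have C_opts: "opts_of p ?C = {|conjugate B|}" "opts_of ?q ?C = {|conjugate A|}"
      using A B by (simp_all add: opts_of_conjugate)
    have smallA: "all_small A" and smallB: "all_small B"
      using abnA abnB by (simp_all add: abn_def)
    have move_A: "A + ?C |\<in>| opts_of p (G + ?C)" and move_B: "G + conjugate B |\<in>| opts_of p (G + ?C)"
      using A C_opts by (simp_all add: opts_of_plus)
    \<comment> \<open>The targets for \<open>p\<close>: a lone component with the opponent to move
      on a run of odd length.\<close>
    have C_win: "\<not> wins_moving_first ?q ?C" if "odd ?l"
      using that wins_moving_first_conjugate_iff[OF less.prems, of ?q] by simp
    have G_win: "\<not> wins_moving_first ?q G" if "odd ?r"
      using that wins_moving_first_iff_even_alt_length[OF less.prems, of ?q] by simp
    have "?l \<le> 3" "?r \<le> 3" using less.prems by (auto intro: abn_alt_length_le)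
    \<comment> \<open>By \<open>lA\<close> and \<open>rB\<close> both lengths are positive, so if
      neither is odd both are 2.\<close>
    then consider "?l = 1" | "?r = 1" | "?l = 3" | "?r = 3" | "?l = 2" "?r = 2"
      using lA rB by linarith
    then show ?thesis
    proof cases
      case 1
      then have "A = 0" using lA alt_length_eq_0_iff[OF smallA] by simp
      then show ?thesis using wins_moving_firstI[OF move_A] C_win 1 by simp
    next
      case 2
      then have "B = 0" using rB alt_length_eq_0_iff[OF smallB] by simp
      then show ?thesis using wins_moving_firstI[OF move_B] G_win 2 by simp
    next
      case 3
      \<comment> \<open>A reply in \<open>?C\<close> is the mirror move. A reply in \<open>A\<close>
        is the second move of the run of length 3; \<open>p\<close> makes the third and leaves
        \<open>?C\<close>.\<close>
      have "\<not> wins_moving_first ?q (A + ?C)"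
      proof (rule not_wins_moving_firstI)
        fix K assume "K |\<in>| opts_of ?q (A + ?C)"
        then consider A' where "A' |\<in>| opts_of ?q A" "K = A' + ?C" | "K = A + conjugate A"
          using C_opts by (auto simp: opts_of_plus)
        then show "wins_moving_first (opponent ?q) K"
        proof cases
          case (1 A')
          have abnA': "abn 3 A'" using abn_option[OF abnA 1(1)] .
          have "A \<noteq> 0" using 1 by auto
          then have "opts_of ?q A = {|A'|}" using abn_opts_of[OF abnA] 1(1) by (metis fsingletonE)
          then have l1: "alt_length p A' = 1" using 3 lA alt_length_singleton[of ?q A A'] by simp
          then have "A' \<noteq> 0" by auto
          then obtain A'' where A'': "opts_of p A' = {|A''|}" using abn_opts_of[OF abnA'] by blast
          then have "A'' = 0"
            using l1 alt_length_singleton[OF A''] alt_length_eq_0_iff[of A''] abn_option[OF abnA', of A'' p]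
            by (simp add: abn_def)
          then have "?C |\<in>| opts_of p K" using 1 A'' by (simp add: opts_of_plus)
          then show ?thesis using wins_moving_firstI C_win 3 by simp
        qed (use IH_A in simp)
      qed (use C_opts in \<open>simp add: opts_of_plus\<close>)
      then show ?thesis using wins_moving_firstI[OF move_A] by simp
    next
      case 4
      \<comment> \<open>The same with the components exchanged: \<open>p\<close> completes the run
        in \<open>?C\<close> and leaves \<open>G\<close>.\<close>
      have "\<not> wins_moving_first ?q (G + conjugate B)"
      proof (rule not_wins_moving_firstI)
        fix K assume "K |\<in>| opts_of ?q (G + conjugate B)"
        then consider B' where "B' |\<in>| opts_of p B" "K = G + conjugate B'" | "K = B + conjugate B"
          using B by (auto simp: opts_of_plus opts_of_conjugate)
        then show "wins_moving_first (opponent ?q) K"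
        proof cases
          case (1 B')
          have abnB': "abn 3 B'" using abn_option[OF abnB 1(1)] .
          have "B \<noteq> 0" using 1 by auto
          then have "opts_of p B = {|B'|}" using abn_opts_of[OF abnB] 1(1) by (metis fsingletonE)
          then have l1: "alt_length ?q B' = 1" using 4 rB alt_length_singleton[of p B B'] by simp
          then have "B' \<noteq> 0" by auto
          then obtain B'' where B'': "opts_of ?q B' = {|B''|}" using abn_opts_of[OF abnB'] by blast
          then have "B'' = 0"
            using l1 alt_length_singleton[OF B''] alt_length_eq_0_iff[of B''] abn_option[OF abnB', of B'' ?q]
            by (simp add: abn_def)
          then have "G |\<in>| opts_of p K" using 1 B'' by (simp add: opts_of_plus opts_of_conjugate)
          then show ?thesis using wins_moving_firstI G_win 4 by simp
        qed (use IH_B in simp)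
      qed (use B in \<open>simp add: opts_of_plus\<close>)
      then show ?thesis using wins_moving_firstI[OF move_B] by simp
    next
      case 5
      \<comment> \<open>Here a reply in \<open>A\<close> ends that component, so \<open>p\<close> is
        to move in \<open>?C\<close>, where the even length \<open>?r\<close> wins.\<close>
      have "\<not> wins_moving_first ?q (A + ?C)"
      proof (rule not_wins_moving_firstI)
        fix K assume "K |\<in>| opts_of ?q (A + ?C)"
        then consider A' where "A' |\<in>| opts_of ?q A" "K = A' + ?C" | "K = A + conjugate A"
          using C_opts by (auto simp: opts_of_plus)
        then show "wins_moving_first (opponent ?q) K"
        proof cases
          case (1 A')
          have "A \<noteq> 0" using 1 by auto
          then have "opts_of ?q A = {|A'|}" using abn_opts_of[OF abnA] 1(1) by (metis fsingletonE)
          then have "alt_length p A' = 0" using 5 lA alt_length_singleton[of ?q A A'] by simp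
          then have "A' = 0"
            using alt_length_eq_0_iff all_small_option[OF smallA 1(1)] by blast
          then show ?thesis
            using 1 5 wins_moving_first_conjugate_iff[OF less.prems, of p] by simp
        qed (use IH_A in simp)
      qed (use C_opts in \<open>simp add: opts_of_plus\<close>)
      then show ?thesis using wins_moving_firstI[OF move_A] by simp
    qed
  qed
qed

section \<open>The mirror strategy\<close>

text \<open>The first assumption ranges over the game tree because mirrored exchanges may have
  replaced \<open>G\<close> by any position in it when \<open>K\<close> runs out. An exchange
  shrinks \<open>G\<close> and a move in \<open>K\<close> shrinks \<open>K\<close>, hence the
  measure.\<close>

lemma wins_moving_first_mirror_sum:
  assumes "\<And>H p. H \<in> game_tree G \<Longrightarrow> wins_moving_first p (H + conjugate H)"
    and "all_small K"
  shows "wins_moving_first p ((G + conjugate G) + K) \<longleftrightarrow> wins_moving_first p K"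
  using assms
proof (induction "size G + size K" arbitrary: p G K rule: less_induct)
  case less
  let ?S = "G + conjugate G" and ?q = "opponent p"
  have IH_K: "wins_moving_first ?q (?S + K') \<longleftrightarrow> wins_moving_first ?q K'"
    if "K' |\<in>| opts_of p K" for K'
    using size_option[OF that]
    by (intro less.hyps less.prems(1) all_small_option[OF less.prems(2) that]) simp_all
  \<comment> \<open>\<open>p'\<close> is independent of \<open>p\<close>: a move of \<open>p\<close>
    in \<open>conjugate G\<close> mirrors an opponent's option of \<open>G\<close>.\<close>
  have IH_G: "wins_moving_first p ((G' + conjugate G') + K) \<longleftrightarrow> wins_moving_first p K"
    if "G' |\<in>| opts_of p' G" for G' p'
    using size_option[OF that]
    by (intro less.hyps less.prems game_tree_option[OF that]) simp_all
  show ?case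
  proof (cases "wins_moving_first p K")
    case True
    have "wins_moving_first p (?S + K)"
    proof (cases "K = 0")
      case True
      then show ?thesis using less.prems(1) game_tree.root by simp
    next
      case False
      \<comment> \<open>As \<open>K\<close> is all-small and nonzero, \<open>p\<close> is not stuck
        in it, so the win comes from an actual move.\<close>
      then obtain K' where K': "K' |\<in>| opts_of p K" "\<not> wins_moving_first ?q K'"
        using True all_small_opts_empty_iff[OF less.prems(2)]
        by (auto simp: wins_moving_first.simps[of p K])
      then have "?S + K' |\<in>| opts_of p (?S + K)" by (simp add: opts_of_plus)
      then show ?thesis using wins_moving_firstI IH_K K' by blast
    qed
    with True show ?thesis by simp
  next
    case False
    have "\<not> wins_moving_first p (?S + K)"
    proof (rule not_wins_moving_firstI)
      \<comment> \<open>A player who loses moving first in \<open>K\<close> has a move in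
        \<open>K\<close>.\<close>
      show "opts_of p (?S + K) \<noteq> {||}"
        using False by (auto simp: opts_of_plus wins_moving_first.simps[of p K])
    next
      fix X assume "X |\<in>| opts_of p (?S + K)"
      then consider K' where "K' |\<in>| opts_of p K" "X = ?S + K'"
        | G' where "G' |\<in>| opts_of p G" "X = (G' + conjugate G) + K"
        | G' where "G' |\<in>| opts_of ?q G" "X = (G + conjugate G') + K"
        by (auto simp: opts_of_plus opts_of_conjugate)
      then show "wins_moving_first ?q X"
      proof cases
        case (1 K')
        then show ?thesis using IH_K False wins_moving_firstI by blast
      next
        case (2 G')
        then have "(G' + conjugate G') + K |\<in>| opts_of ?q X"
          by (auto simp: opts_of_plus opts_of_conjugate)
        then show ?thesis using IH_G[OF 2(1)] False by (auto intro: wins_moving_firstI)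
      next
        case (3 G')
        then have "(G' + conjugate G') + K |\<in>| opts_of ?q X"
          by (auto simp: opts_of_plus opts_of_conjugate)
        then show ?thesis using IH_G[OF 3(1)] False by (auto intro: wins_moving_firstI)
      qed
    qed
    with False show ?thesis by simp
  qed
qed

lemma abn_game_tree: "H \<in> game_tree G \<Longrightarrow> abn n G \<Longrightarrow> abn n H"
  by (induction rule: game_tree.induct) (auto intro: abn_option)

theorem theorem5p2p6:
  fixes \<xi> :: game
  assumes "abn 3 \<xi>"
  shows "equiv_mod (\<xi> + conjugate \<xi>) 0 (cl \<xi> (conjugate \<xi>))"
  unfolding equiv_mod_def
proof
  fix K assume K: "K \<in> cl \<xi> (conjugate \<xi>)"
  have "all_small \<xi>" using assms by (simp add: abn_def)
  then have "all_small K" using all_small_cl[OF _ all_small_conjugate K] by simp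
  then have "wins_moving_first p ((\<xi> + conjugate \<xi>) + K) \<longleftrightarrow> wins_moving_first p K" for p
    by (intro wins_moving_first_mirror_sum abn_3_wins_plus_conjugate abn_game_tree[OF _ assms])
  then show "misere_outcome (\<xi> + conjugate \<xi> + K) = misere_outcome (0 + K)"
    by (simp add: misere_outcome_def)
qed

end
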